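(* Let $p$ be a prime and let $A$ be a nonzero commutative nilpotent $\mathbb{F}_p$-algebra of finite dimension with $A^p=0$, and let $e\ge1$ be the integer with $A^e\ne0$ and $A^{e+1}=0$. Let $i(A)$ be the number of ideals of $A$ and $s(A)$ the number of $\mathbb{F}_p$-subspaces of $A$. Then \[ \frac{i(A)}{s(A)}\le\frac{2e-1}{p^{\lfloor e^2/4\rfloor}}. \]
   Context: Algebras are commutative, associative, not necessarily unital. *)

theory Defs
  imports Complex_Main "HOL-Computational_Algebra.Primes"
begin

text \<open>The algebra A is the whole (finite) carrier of a type 'a of class comm_ring
  (commutative, associative, not necessarily unital ring). Being an F_p-algebra
  means the additive group has exponent p (p x = 0 for all x); then the F_p-action
  is the induced Z-action and bilinearity is automatic.\<close>

definition char_p_alg :: "nat \<Rightarrow> 'a::comm_ring itself \<Rightarrow> bool" where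
  "char_p_alg p _ \<longleftrightarrow> (\<forall>x::'a. (\<Sum>_<p. x) = 0)"

text \<open>Product of a nonempty list of elements (non-unital, so no empty product).\<close>
fun nprod :: "'a::comm_ring list \<Rightarrow> 'a" where
  "nprod [] = undefined"
| "nprod [x] = x"
| "nprod (x # y # xs) = x * nprod (y # xs)"

text \<open>Additive subgroup (= F_p-subspace) generated by a set.\<close>
inductive_set addspan :: "'a::ab_group_add set \<Rightarrow> 'a set" for S where
  zero: "0 \<in> addspan S"
| base: "x \<in> S \<Longrightarrow> x \<in> addspan S"
| add: "x \<in> addspan S \<Longrightarrow> y \<in> addspan S \<Longrightarrow> x + y \<in> addspan S"
| neg: "x \<in> addspan S \<Longrightarrow> - x \<in> addspan S"

definition alg_pow :: "nat \<Rightarrow> 'a::comm_ring set" where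
  "alg_pow k = addspan {nprod xs | xs. length xs = k}"

text \<open>F_p-subspaces of A (for an additive group of exponent p, these are exactly
  the additive subgroups).\<close>
definition fp_subspace :: "'a::comm_ring set \<Rightarrow> bool" where
  "fp_subspace S \<longleftrightarrow> 0 \<in> S \<and> (\<forall>x\<in>S. \<forall>y\<in>S. x + y \<in> S) \<and> (\<forall>x\<in>S. - x \<in> S)"

definition alg_ideal :: "'a::comm_ring set \<Rightarrow> bool" where
  "alg_ideal I \<longleftrightarrow> fp_subspace I \<and> (\<forall>a x. x \<in> I \<longrightarrow> a * x \<in> I)"

end

theory Submission
  imports Defs "HOL-Library.Set_Algebras"
begin

text \<open>As \<open>e < p\<close>, polarization yields \<open>a\<close> and \<open>c\<close> with \<open>a\<^sup>e\<^sup>-\<^sup>1 c \<noteq> 0\<close>. Ideals are invariant under the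
  nilpotent map \<open>L x = a x\<close>, and \<open>c\<close> generates an \<open>L\<close>-invariant subspace \<open>B\<close> of dimension \<open>e\<close> on which
  \<open>L\<close> is a single Jordan block. Sort the subspaces \<open>S\<close> by \<open>T = S + B\<close>. For a fixed invariant \<open>T\<close>, an invariant
  \<open>S\<close> meets \<open>B\<close> in one of its \<open>e + 1\<close> invariant subspaces, and for each of these there are at most
  \<open>|T/B|\<close> choices of \<open>S\<close>: climb from \<open>B\<close> to \<open>T\<close> by adjoining vectors \<open>x\<close> with \<open>L x\<close> in the space reached so far;
  two extensions of \<open>S\<close> differ by an element of \<open>B\<close> that \<open>L\<close> maps into \<open>S \<inter> B\<close>, which leaves at most \<open>p\<close> of them.
  On the other hand the complements in \<open>T\<close> of a subspace \<open>D\<close> of \<open>B\<close> of dimension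
  \<open>e - \<lfloor>e/2\<rfloor>\<close> already provide \<open>p\<close> to the power \<open>\<lfloor>e\<^sup>2/4\<rfloor>\<close> times \<open>|T/B|\<close> subspaces \<open>S\<close> with \<open>S + B = T\<close>. This gives
  the factor \<open>e + 1 \<le> 2 e - 1\<close> when \<open>e \<ge> 2\<close>; for \<open>e = 1\<close> the bound is trivial.\<close>

section \<open>Multiples and subspaces\<close>

text \<open>Stands in for the action of F_p: scalars are represented by natural numbers, which
  \<open>nmul_mod\<close> later allows to be reduced modulo \<open>p\<close>.\<close>

definition nmul :: "nat \<Rightarrow> 'a::comm_monoid_add \<Rightarrow> 'a" where
  "nmul n x = (\<Sum>_<n. x)"

lemma nmul_0 [simp]: "nmul 0 x = 0"
  by (simp add: nmul_def)

lemma nmul_Suc [simp]: "nmul (Suc n) x = x + nmul n x"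
  by (simp add: nmul_def add.commute)

lemma nmul_zero [simp]: "nmul n 0 = 0"
  by (simp add: nmul_def)

lemma nmul_add_left: "nmul (m + n) x = nmul m x + nmul n x"
  by (induction m) (simp_all add: add.assoc)

lemma nmul_add_right: "nmul n (x + y) = nmul n x + nmul n y"
  by (simp add: nmul_def sum.distrib)

lemma nmul_mult: "nmul (m * n) x = nmul m (nmul n x)"
  by (induction m) (simp_all add: nmul_add_left)

lemma mult_nmul: "a * nmul n x = nmul n (a * x)" for a :: "'a::comm_ring"
  by (simp add: nmul_def sum_distrib_left)

lemma additive_0:
  fixes L :: "'a::ab_group_add \<Rightarrow> 'a"
  assumes "\<And>x y. L (x + y) = L x + L y"
  shows "L 0 = 0"
  using assms[of 0 0] by simp

lemma additive_diff:
  fixes L :: "'a::ab_group_add \<Rightarrow> 'a"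
  assumes "\<And>x y. L (x + y) = L x + L y"
  shows "L (x - y) = L x - L y"
  using assms[of "x - y" y] by (simp add: algebra_simps)

lemma additive_nmul:
  fixes L :: "'a::ab_group_add \<Rightarrow> 'a"
  assumes "\<And>x y. L (x + y) = L x + L y"
  shows "L (nmul n x) = nmul n (L x)"
  by (induction n) (simp_all add: assms additive_0[OF assms])

section \<open>Closure properties and sums of subspaces\<close>

lemma subspace_0: "fp_subspace S \<Longrightarrow> 0 \<in> S"
  and subspace_add: "fp_subspace S \<Longrightarrow> x \<in> S \<Longrightarrow> y \<in> S \<Longrightarrow> x + y \<in> S"
  and subspace_neg: "fp_subspace S \<Longrightarrow> x \<in> S \<Longrightarrow> - x \<in> S"
  by (auto simp: fp_subspace_def)

lemma subspace_diff: "fp_subspace S \<Longrightarrow> x \<in> S \<Longrightarrow> y \<in> S \<Longrightarrow> x - y \<in> S"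
  using subspace_add[of S x "- y"] subspace_neg[of S y] by simp

lemma subspace_nmul: "fp_subspace S \<Longrightarrow> x \<in> S \<Longrightarrow> nmul n x \<in> S"
  by (induction n) (auto simp: subspace_0 subspace_add)

lemma subspace_zero: "fp_subspace {0}"
  by (simp add: fp_subspace_def)

lemma subspace_inter: "fp_subspace S \<Longrightarrow> fp_subspace T \<Longrightarrow> fp_subspace (S \<inter> T)"
  by (simp add: fp_subspace_def)

lemma subspace_plus:
  assumes S: "fp_subspace S" and T: "fp_subspace T"
  shows "fp_subspace (S + T)"
proof -
  have "0 + 0 \<in> S + T" using assms by (intro set_plus_intro subspace_0)
  moreover have "x + y \<in> S + T" if x: "x \<in> S + T" and y: "y \<in> S + T" for x y
  proof -
    obtain a b where ab: "x = a + b" "a \<in> S" "b \<in> T" using x by (rule set_plus_elim)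
    obtain c d where cd: "y = c + d" "c \<in> S" "d \<in> T" using y by (rule set_plus_elim)
    have "(a + c) + (b + d) \<in> S + T"
      using ab cd assms by (intro set_plus_intro subspace_add)
    then show ?thesis using ab cd by (simp add: algebra_simps)
  qed
  moreover have "- x \<in> S + T" if x: "x \<in> S + T" for x
  proof -
    obtain a b where ab: "x = a + b" "a \<in> S" "b \<in> T" using x by (rule set_plus_elim)
    have "- a + - b \<in> S + T" using ab assms by (intro set_plus_intro subspace_neg)
    then show ?thesis using ab by simp
  qed
  ultimately show ?thesis by (simp add: fp_subspace_def)
qed

lemma subset_plus_left: "fp_subspace T \<Longrightarrow> S \<subseteq> S + T"
  using set_plus_intro[of _ S 0 T] subspace_0 by fastforce

lemma subset_plus_right: "fp_subspace S \<Longrightarrow> T \<subseteq> S + T"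
  using set_plus_intro[of 0 S _ T] subspace_0 by fastforce

lemma plus_subset:
  assumes "fp_subspace U" "S \<subseteq> U" "T \<subseteq> U"
  shows "S + T \<subseteq> U"
  using assms by (auto elim!: set_plus_elim intro!: subspace_add)

lemma addspan_subspace: "fp_subspace (addspan S)" for S :: "'a::comm_ring set"
  by (auto simp: fp_subspace_def intro: addspan.intros)

section \<open>Finite groups of exponent \<open>p\<close> and their lines\<close>

locale elementary_abelian =
  fixes p :: nat and ty :: "'a::{comm_ring, finite} itself"
  assumes prime: "prime p"
    and exponent: "nmul p (x :: 'a) = 0"
begin

lemma p_gt_1: "p > 1"
  using prime by (rule prime_gt_1_nat)

lemma nmul_mod: "nmul (n mod p) x = nmul n (x :: 'a)"
proof -
  have "nmul n x = nmul (n div p * p + n mod p) x" by simp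
  also have "\<dots> = nmul (n mod p) x"
    by (simp only: nmul_add_left nmul_mult exponent nmul_zero add_0)
  finally show ?thesis by simp
qed

text \<open>Bezout makes \<open>n\<close> invertible modulo \<open>p\<close>, so a further multiple
  of \<open>nmul n x\<close> is \<open>x\<close> itself.\<close>

lemma nmul_cancel:
  assumes "fp_subspace H" "nmul n (x :: 'a) \<in> H" "\<not> p dvd n"
  shows "x \<in> H"
proof -
  have "coprime n p"
    using assms(3) prime by (metis coprime_commute prime_imp_coprime)
  moreover have "n \<noteq> 0" using assms(3) by (metis dvd_0_right)
  ultimately obtain u v where "n * u = p * v + 1"
    using bezout_nat[of n p] by auto
  then have "nmul (u * n) x = nmul (v * p + 1) x" by (simp add: mult.commute)
  also have "\<dots> = x" by (simp add: nmul_add_left nmul_mult exponent)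
  finally have "x = nmul u (nmul n x)" by (simp add: nmul_mult)
  then show ?thesis using subspace_nmul[OF assms(1,2), of u] by simp
qed

lemma nmul_neg: "- nmul n x = nmul (n * (p - 1)) (x :: 'a)"
proof -
  have "nmul n x + nmul (n * (p - 1)) x = nmul (n * p) x"
    using p_gt_1 by (cases p) (simp_all flip: nmul_add_left)
  also have "\<dots> = 0" by (simp add: nmul_mult exponent)
  finally show ?thesis by (simp add: minus_unique)
qed

definition line :: "'a \<Rightarrow> 'a set" where
  "line x = range (\<lambda>n. nmul n x)"

lemma line_subspace: "fp_subspace (line x)"
proof -
  have "0 \<in> line x" unfolding line_def using nmul_0 by (metis rangeI)
  moreover have "u + v \<in> line x" if "u \<in> line x" "v \<in> line x" for u v
    using that by (auto simp: line_def simp flip: nmul_add_left)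
  moreover have "- u \<in> line x" if "u \<in> line x" for u
    using that by (auto simp: line_def nmul_neg)
  ultimately show ?thesis by (simp add: fp_subspace_def)
qed

lemma mem_line: "x \<in> line x"
  unfolding line_def by (metis nmul_Suc nmul_0 add_0_right rangeI)

lemma line_subset: "fp_subspace S \<Longrightarrow> x \<in> S \<Longrightarrow> line x \<subseteq> S"
  by (auto simp: line_def subspace_nmul)

lemma mem_plus_line: "y \<in> H + line x \<longleftrightarrow> (\<exists>h\<in>H. \<exists>n. y = h + nmul n x)"
  by (auto simp: line_def set_plus_def)

text \<open>An instance of the modular law: a multiple of \<open>x\<close> lying in \<open>K\<close>
  has coefficient divisible by \<open>p\<close>, hence is 0, so \<open>S + line x\<close> meets
  \<open>K\<close> only in \<open>S\<close>.\<close>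

lemma plus_line_modular:
  assumes K: "fp_subspace K" and S: "S \<subseteq> K" and xk: "x \<notin> K"
    and y: "y \<in> S + line x" "y \<in> K"
  shows "y \<in> S"
proof -
  obtain h n where hn: "h \<in> S" "y = h + nmul n x" using y by (auto simp: mem_plus_line)
  have "y - h \<in> K" using hn y S K by (intro subspace_diff) auto
  then have "nmul n x \<in> K" using hn by simp
  then have "p dvd n" using nmul_cancel[OF K] xk by blast
  then have "nmul n x = 0" by (metis nmul_mod dvd_imp_mod_0 nmul_0)
  then show ?thesis using hn by simp
qed

lemma card_plus_line_le: "card (H + line x) \<le> p * card H"
proof -
  have "H + line x \<subseteq> (\<lambda>(h, n). h + nmul n x) ` (H \<times> {..<p})"
  proof
    fix y assume "y \<in> H + line x"
    then obtain h n where "h \<in> H" "y = h + nmul (n mod p) x"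
      by (auto simp: mem_plus_line nmul_mod)
    moreover have "n mod p < p" using p_gt_1 by simp
    ultimately show "y \<in> (\<lambda>(h, n). h + nmul n x) ` (H \<times> {..<p})" by force
  qed
  then have "card (H + line x) \<le> card ((\<lambda>(h, n). h + nmul n x) ` (H \<times> {..<p}))"
    by (intro card_mono) auto
  also have "\<dots> \<le> card (H \<times> {..<p})" by (intro card_image_le) auto
  finally show ?thesis by (simp add: mult.commute)
qed

lemma card_plus_line:
  assumes H: "fp_subspace H" and x: "x \<notin> H"
  shows "card (H + line x) = p * card H"
proof -
  \<comment> \<open>Subtraction of naturals is truncated, so the coefficients are compared in one
    order first; the other order follows by symmetry.\<close>
  have *: "m = n" if "m \<le> n" "n < p" "h \<in> H" "k \<in> H" "h + nmul m x = k + nmul n x" for m n h k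
  proof -
    have "nmul n x = nmul m x + nmul (n - m) x" using that by (simp flip: nmul_add_left)
    then have "nmul (n - m) x = h - k" using that by (simp add: algebra_simps)
    then have "p dvd n - m"
      using nmul_cancel[OF H, of "n - m" x] subspace_diff[OF H, of h k] that x by auto
    then show ?thesis using that by (auto dest!: dvd_imp_le)
  qed
  have "inj_on (\<lambda>(h, n). h + nmul n x) (H \<times> {..<p})"
  proof (rule inj_onI, clarify)
    fix h m k n assume a: "h \<in> H" "k \<in> H" "m < p" "n < p"
      "h + nmul m x = k + nmul n x"
    have "m = n"
    proof (cases "m \<le> n")
      case True
      then show ?thesis using a(4,1,2,5) by (rule *)
    next
      case False
      then have "n \<le> m" by simp
      then have "n = m" using a(3,2,1) a(5)[symmetric] by (rule *)
      then show ?thesis ..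
    qed
    then show "h = k \<and> m = n" using a by simp
  qed
  then have "card (H \<times> {..<p}) = card ((\<lambda>(h, n). h + nmul n x) ` (H \<times> {..<p}))"
    by (simp add: card_image)
  also have "\<dots> \<le> card (H + line x)"
    by (intro card_mono) (auto intro!: set_plus_intro simp: line_def)
  finally show ?thesis using card_plus_line_le[of H x] by (simp add: mult.commute)
qed

section \<open>Invariant chains of a nilpotent endomorphism\<close>

text \<open>Take \<open>z\<close> in \<open>T\<close> outside \<open>K\<close>. Nilpotency brings
  its iterates into \<open>K\<close>, and the last one before the first entry is an \<open>x\<close>
  outside \<open>K\<close> with \<open>L x\<close> in \<open>K\<close>. Adjoining \<open>x\<close>
  keeps invariance, and the climb ends because \<open>T\<close> is finite.\<close>

lemma invariant_chain_induct [consumes 7, case_names base step]: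
  fixes L :: "'a \<Rightarrow> 'a"
  assumes add: "\<And>x y. L (x + y) = L x + L y" and nil: "\<And>x. (L ^^ N) x = 0"
    and B: "fp_subspace B" and T: "fp_subspace T" "L ` T \<subseteq> T"
    and BT: "B \<subseteq> T" and LB: "L ` B \<subseteq> B"
    and base: "P B"
    and step: "\<And>K x. fp_subspace K \<Longrightarrow> L ` K \<subseteq> K \<Longrightarrow> B \<subseteq> K \<Longrightarrow> K \<subseteq> T \<Longrightarrow> x \<in> T \<Longrightarrow> x \<notin> K
      \<Longrightarrow> L x \<in> K \<Longrightarrow> P K \<Longrightarrow> P (K + line x)"
  shows "P T"
proof -
  have "P T" if "fp_subspace K" "L ` K \<subseteq> K" "B \<subseteq> K" "K \<subseteq> T" "P K" for K
    using that
  proof (induction "card T - card K" arbitrary: K rule: less_induct)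
    case less
    show ?case
    proof (cases "K = T")
      case True
      then show ?thesis using less by simp
    next
      case False
      then obtain z where z: "z \<in> T" "z \<notin> K" using less by blast
      define i where "i = (LEAST i. (L ^^ i) z \<in> K)"
      have i: "(L ^^ i) z \<in> K"
        unfolding i_def by (rule LeastI[of _ N]) (simp add: nil subspace_0 less.prems)
      then obtain j where j: "i = Suc j" using z by (cases i) auto
      define x where "x = (L ^^ j) z"
      have xK: "x \<notin> K"
        using not_less_Least[of j "\<lambda>i. (L ^^ i) z \<in> K"] j by (simp add: x_def i_def)
      have "(L ^^ k) z \<in> T" for k using z T(2) by (induction k) auto
      then have xT: "x \<in> T" by (simp add: x_def)
      have Lx: "L x \<in> K" using i by (simp add: x_def j)
      let ?K = "K + line x"
      have sub: "fp_subspace ?K" using less.prems by (intro subspace_plus line_subspace)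
      have KK: "K \<subseteq> ?K" by (intro subset_plus_left line_subspace)
      have inv: "L ` ?K \<subseteq> ?K"
      proof
        fix y assume "y \<in> L ` ?K"
        then obtain h n where "h \<in> K" "y = L (h + nmul n x)" by (auto simp: mem_plus_line)
        moreover have "L h + nmul n (L x) \<in> K" if "h \<in> K" for h n
          using that less.prems Lx by (intro subspace_add subspace_nmul) auto
        ultimately have "y \<in> K" by (simp add: add additive_nmul[OF add])
        then show "y \<in> ?K" using KK by auto
      qed
      have KT: "?K \<subseteq> T" using T less.prems xT by (intro plus_subset line_subset) auto
      have "card ?K > card K"
        using card_plus_line[OF less.prems(1) xK] p_gt_1 subspace_0[OF less.prems(1)]
        by (auto simp: card_gt_0_iff)
      moreover have "card ?K \<le> card T" using KT by (intro card_mono) auto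
      ultimately have "card T - card ?K < card T - card K" by linarith
      then show ?thesis
        using less.hyps[of ?K] sub inv KT KK less.prems step[OF less.prems(1-4) xT xK Lx less.prems(5)]
        by blast
    qed
  qed
  from this[of B] show ?thesis using assms by blast
qed

text \<open>The case of the zero map, for which every subspace is invariant.\<close>

lemma chain_induct [consumes 3, case_names base step]:
  assumes "fp_subspace B" "fp_subspace (T :: 'a set)" "B \<subseteq> T"
    and "P B"
    and "\<And>K x. fp_subspace K \<Longrightarrow> B \<subseteq> K \<Longrightarrow> K \<subseteq> T \<Longrightarrow> x \<in> T \<Longrightarrow> x \<notin> K \<Longrightarrow> P K \<Longrightarrow> P (K + line x)"
  shows "P T"
  by (rule invariant_chain_induct[of "\<lambda>_. 0" 1 B T P])
    (use assms subspace_0 in auto)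

lemma card_subspace_over:
  assumes "fp_subspace B" "fp_subspace (T :: 'a set)" "B \<subseteq> T"
  shows "\<exists>t. card T = card B * p ^ t"
  using assms
proof (induction rule: chain_induct)
  case base
  then show ?case by (rule exI[of _ 0]) simp
next
  case (step K x)
  then obtain t where "card K = card B * p ^ t" by blast
  then have "card (K + line x) = card B * p ^ Suc t" using step card_plus_line by simp
  then show ?case by blast
qed

text \<open>A chain from \<open>{0}\<close> to \<open>T\<close> that grows by a factor
  \<open>p\<close> at each step passes through every intermediate power of \<open>p\<close>.\<close>

lemma exists_subspace_card:
  assumes T: "fp_subspace (T :: 'a set)" and c: "card T = p ^ e" and g: "g \<le> e"
  shows "\<exists>D. fp_subspace D \<and> D \<subseteq> T \<and> card D = p ^ g"
proof -
  have "{0} \<subseteq> T" using T subspace_0 by auto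
  with subspace_zero T have "\<exists>k. card T = p ^ k \<and> (\<forall>g\<le>k. \<exists>D. fp_subspace D \<and> D \<subseteq> T \<and> card D = p ^ g)"
  proof (induction rule: chain_induct)
    case base
    then show ?case by (intro exI[of _ 0]) (auto intro!: exI[of _ "{0}"] subspace_zero)
  next
    case (step K x)
    then obtain k where k: "card K = p ^ k" "\<And>g. g \<le> k \<Longrightarrow> \<exists>D. fp_subspace D \<and> D \<subseteq> K \<and> card D = p ^ g"
      by blast
    have c: "card (K + line x) = p ^ Suc k" using step k card_plus_line by simp
    have KK: "K \<subseteq> K + line x" by (intro subset_plus_left line_subspace)
    have s: "fp_subspace (K + line x)" using step by (intro subspace_plus line_subspace)
    have "\<exists>D. fp_subspace D \<and> D \<subseteq> K + line x \<and> card D = p ^ g" if "g \<le> Suc k" for g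
    proof (cases "g \<le> k")
      case True
      then show ?thesis using k(2)[of g] KK by blast
    next
      case False
      then have "g = Suc k" using that by simp
      then show ?thesis using c s by blast
    qed
    then show ?case using c by blast
  qed
  then obtain k where "card T = p ^ k" "\<forall>g\<le>k. \<exists>D. fp_subspace D \<and> D \<subseteq> T \<and> card D = p ^ g"
    by blast
  moreover have "k = e" using \<open>card T = p ^ k\<close> c p_gt_1 by (simp add: power_inject_exp)
  ultimately show ?thesis using g by blast
qed

section \<open>Counting complements\<close>

text \<open>A complement \<open>S\<close> of \<open>D\<close> in \<open>K\<close> extends to the
  complements \<open>S + line (x + d)\<close> of \<open>D\<close> in \<open>K + line x\<close>, one
  for each \<open>d\<close> in \<open>D\<close>, all of them distinct. Each step of the chain thus
  multiplies the count by at least \<open>card D\<close>.\<close>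

lemma card_complements:
  assumes D: "fp_subspace D" and T: "fp_subspace (T :: 'a set)" and DT: "D \<subseteq> T"
  shows "\<exists>t. card T = card D * p ^ t \<and>
    card D ^ t \<le> card {S. fp_subspace S \<and> S \<inter> D = {0} \<and> S + D = T}"
  using D T DT
proof (induction rule: chain_induct)
  case base
  let ?F = "{S. fp_subspace S \<and> S \<inter> D = {0} \<and> S + D = D}"
  have "{0} \<inter> D = {0}" "{0} + D = D"
    using subspace_0[OF D] by (auto simp: set_plus_def)
  then have "{0} \<in> ?F"
    by (intro CollectI conjI subspace_zero)
  then have "?F \<noteq> {}" by (metis empty_iff)
  then have "0 < card ?F" by (simp only: card_gt_0_iff finite simp_thms)
  then show ?case by (intro exI[of _ 0] conjI) simp_all
next
  case (step K x)
  let ?F = "\<lambda>T. {S. fp_subspace S \<and> S \<inter> D = {0} \<and> S + D = T}"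
  obtain t where t: "card K = card D * p ^ t" "card D ^ t \<le> card (?F K)" using step by blast
  have xd: "x + d \<notin> K" if "d \<in> D" for d
    using subspace_diff[OF step(1), of "x + d" d] step that by auto
  have SK: "S \<subseteq> K" if "S \<in> ?F K" for S
    using that subset_plus_left[OF D, of S] by auto
  have "inj_on (\<lambda>(S, d). S + line (x + d)) (?F K \<times> D)"
  proof (rule inj_onI, clarify)
    fix S d S' d'
    assume d: "d \<in> D" "d' \<in> D" and eq: "S + line (x + d) = S' + line (x + d')"
      and S: "fp_subspace S" "S \<inter> D = {0}" "K = S + D"
      and S': "fp_subspace S'" "S' \<inter> D = {0}" "S' + D = S + D"
    have F: "S \<in> ?F K" "S' \<in> ?F K" using S S' by auto
    \<comment> \<open>An extended complement returns the original one when intersected with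
      \<open>K\<close>.\<close>
    have S_eq: "U = (U + line (x + c)) \<inter> K" if "U \<in> ?F K" "c \<in> D" for U c
      using plus_line_modular[OF step(1) SK[OF that(1)] xd[OF that(2)]] SK[OF that(1)]
        subset_plus_left[OF line_subspace, of U] by blast
    have SS: "S = S'" using S_eq[OF F(1) d(1)] S_eq[OF F(2) d(2)] eq by simp
    have sub: "fp_subspace (S + line (x + d))" using S by (intro subspace_plus line_subspace)
    have "x + d \<in> S + line (x + d)" "x + d' \<in> S + line (x + d)"
      using eq subset_plus_right[OF S(1), of "line (x + d)"] subset_plus_right[OF S'(1), of "line (x + d')"] mem_line
      by blast+
    then have "(x + d) - (x + d') \<in> S + line (x + d)" by (intro subspace_diff sub)
    then have dd: "d - d' \<in> S + line (x + d)" by simp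
    \<comment> \<open>The difference lies in \<open>D\<close> and, by the modular law, in
      \<open>S\<close>; these meet only in 0.\<close>
    have "d - d' \<in> D" using d D by (intro subspace_diff)
    then have "d - d' \<in> S" using plus_line_modular[OF step(1) SK[OF F(1)] xd[OF d(1)] dd] step by blast
    then have "d - d' = 0" using \<open>d - d' \<in> D\<close> S by blast
    then show "S = S' \<and> d = d'" using SS by simp
  qed
  then have "card (?F K \<times> D) = card ((\<lambda>(S, d). S + line (x + d)) ` (?F K \<times> D))"
    by (simp only: card_image)
  also have "\<dots> \<le> card (?F (K + line x))"
  proof (intro card_mono finite)
    show "(\<lambda>(S, d). S + line (x + d)) ` (?F K \<times> D) \<subseteq> ?F (K + line x)"
    proof clarify
      fix S d
      assume d: "d \<in> D" and S: "fp_subspace S" "S \<inter> D = {0}" "K = S + D"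
      have F: "S \<in> ?F K" using S by auto
      let ?S = "S + line (x + d)"
      have sub: "fp_subspace ?S" using S by (intro subspace_plus line_subspace)
      have int: "?S \<inter> D \<subseteq> {0}"
        using plus_line_modular[OF step(1) SK[OF F] xd[OF d]] S(2) step(2) by blast
      have int': "?S \<inter> D = {0}" using int sub D subspace_0 by blast
      have sT: "fp_subspace (K + line x)" using step by (intro subspace_plus line_subspace)
      have KT: "K \<subseteq> K + line x" by (intro subset_plus_left line_subspace)
      have xT: "x \<in> K + line x" using subset_plus_right[OF step(1), of "line x"] mem_line by blast
      have "x + d \<in> K + line x" using xT d step KT by (intro subspace_add sT) auto
      then have "?S + D \<subseteq> K + line x"
        using SK[OF F] KT step by (intro plus_subset sT line_subset) auto
      moreover have "K + line x \<subseteq> ?S + D"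
      proof -
        have sSD: "fp_subspace (?S + D)" using sub D by (rule subspace_plus)
        have "S \<subseteq> ?S" by (rule subset_plus_left[OF line_subspace])
        also have SSD: "?S \<subseteq> ?S + D" by (rule subset_plus_left[OF D])
        finally have "S \<subseteq> ?S + D" .
        moreover have DSD: "D \<subseteq> ?S + D" by (rule subset_plus_right[OF sub])
        ultimately have "K \<subseteq> ?S + D" unfolding S(3) by (intro plus_subset sSD)
        moreover have "x + d \<in> ?S + D"
          by (rule subsetD[OF SSD subsetD[OF subset_plus_right[OF S(1)] mem_line]])
        then have "(x + d) - d \<in> ?S + D" using subsetD[OF DSD d] by (rule subspace_diff[OF sSD])
        then have "x \<in> ?S + D" by simp
        ultimately show ?thesis by (intro plus_subset sSD line_subset)
      qed
      ultimately have "?S + D = K + line x" by (rule equalityI)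
      with sub int' show "fp_subspace ?S \<and> ?S \<inter> D = {0} \<and> ?S + D = S + D + line x"
        unfolding S(3) by (intro conjI)
    qed
  qed
  finally have "card (?F K) * card D \<le> card (?F (K + line x))" by (simp add: card_cartesian_product)
  with mult_le_mono1[OF t(2)] have "card D ^ t * card D \<le> card (?F (K + line x))"
    by (rule le_trans)
  then have "card D ^ Suc t \<le> card (?F (K + line x))" by (simp only: power_Suc2)
  moreover have "card (K + line x) = card D * p ^ Suc t"
    using t(1) card_plus_line[OF step(1,5)] by simp
  ultimately show ?case by (intro exI[of _ "Suc t"] conjI)
qed

section \<open>Counting invariant subspaces\<close>

text \<open>Every nonempty fiber of \<open>L\<close> on \<open>B\<close> is a translate of the
  kernel.\<close>

lemma card_preimage_le:
  fixes L :: "'a \<Rightarrow> 'a"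
  assumes add: "\<And>x y. L (x + y) = L x + L y" and B: "fp_subspace B"
  shows "card {b \<in> B. L b \<in> W} \<le> card W * card {b \<in> B. L b = 0}"
proof -
  have fiber: "card {b \<in> B. L b = w} \<le> card {b \<in> B. L b = 0}" for w
  proof (cases "{b \<in> B. L b = w} = {}")
    case True
    then show ?thesis by (simp only: card.empty le0)
  next
    case False
    then obtain b0 where b0: "b0 \<in> B" "L b0 = w" by blast
    have "b \<in> (+) b0 ` {b \<in> B. L b = 0}" if "b \<in> B" "L b = w" for b
    proof (rule image_eqI)
      show "b = b0 + (b - b0)" by simp
      show "b - b0 \<in> {b \<in> B. L b = 0}"
        using that b0 subspace_diff[OF B] by (simp add: additive_diff[OF add])
    qed
    then have "{b \<in> B. L b = w} \<subseteq> (+) b0 ` {b \<in> B. L b = 0}" by blast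
    then have "card {b \<in> B. L b = w} \<le> card ((+) b0 ` {b \<in> B. L b = 0})"
      by (intro card_mono finite)
    also have "\<dots> \<le> card {b \<in> B. L b = 0}" by (intro card_image_le finite)
    finally show ?thesis .
  qed
  have "{b \<in> B. L b \<in> W} = (\<Union>w\<in>W. {b \<in> B. L b = w})" by blast
  then have "card {b \<in> B. L b \<in> W} \<le> (\<Sum>w\<in>W. card {b \<in> B. L b = w})"
    by (simp only: card_UN_le finite)
  also have "\<dots> \<le> (\<Sum>w\<in>W. card {b \<in> B. L b = 0})" by (intro sum_mono fiber)
  finally show ?thesis by simp
qed

text \<open>Half of the first isomorphism theorem: with a section \<open>\<sigma>\<close> of
  \<open>L\<close> on its image, \<open>(w, k)\<close> goes injectively to
  \<open>\<sigma> w + k\<close> in \<open>B\<close>.\<close>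

lemma card_kernel_image_le:
  fixes L :: "'a \<Rightarrow> 'a"
  assumes add: "\<And>x y. L (x + y) = L x + L y" and B: "fp_subspace B"
  shows "card (L ` B) * card {b \<in> B. L b = 0} \<le> card B"
proof -
  define \<sigma> where "\<sigma> = inv_into B L"
  have \<sigma>: "\<sigma> w \<in> B" "L (\<sigma> w) = w" if "w \<in> L ` B" for w
    using that by (auto simp: \<sigma>_def inv_into_into f_inv_into_f)
  have "inj_on (\<lambda>(w, k). \<sigma> w + k) (L ` B \<times> {b \<in> B. L b = 0})"
  proof (rule inj_onI, clarsimp simp del: imageE)
    fix b k b' k'
    assume "b \<in> B" "b' \<in> B" and k: "L k = 0" "L k' = 0" and eq: "\<sigma> (L b) + k = \<sigma> (L b') + k'"
    then have "L (\<sigma> (L b)) = L b" "L (\<sigma> (L b')) = L b'" using \<sigma> by blast+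
    then have "L b = L b'" using arg_cong[OF eq, of L] k by (simp add: add)
    then show "L b = L b' \<and> k = k'" using eq by simp
  qed
  moreover have "(\<lambda>(w, k). \<sigma> w + k) ` (L ` B \<times> {b \<in> B. L b = 0}) \<subseteq> B"
    using \<sigma> subspace_add[OF B] by auto
  ultimately have "card (L ` B \<times> {b \<in> B. L b = 0}) \<le> card B"
    by (intro card_inj_on_le finite)
  then show ?thesis by (simp only: card_cartesian_product)
qed

text \<open>The kernel of \<open>L ^^ Suc k\<close> is the preimage of the kernel of
  \<open>L ^^ k\<close>, so it is larger by a factor of at most \<open>p\<close>.\<close>

lemma card_kernel_funpow_le:
  fixes L :: "'a \<Rightarrow> 'a"
  assumes add: "\<And>x y. L (x + y) = L x + L y" and B: "fp_subspace B" "L ` B \<subseteq> B"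
    and ker: "card {b \<in> B. L b = 0} \<le> p"
  shows "card {b \<in> B. (L ^^ k) b = 0} \<le> p ^ k"
proof (induction k)
  case 0
  have "card {b \<in> B. b = 0} \<le> card {0 :: 'a}" by (intro card_mono) auto
  then show ?case by simp
next
  case (Suc k)
  have "{b \<in> B. (L ^^ Suc k) b = 0} = {b \<in> B. L b \<in> {b \<in> B. (L ^^ k) b = 0}}"
    using B(2) by (auto simp: funpow_swap1)
  then have "card {b \<in> B. (L ^^ Suc k) b = 0}
      \<le> card {b \<in> B. (L ^^ k) b = 0} * card {b \<in> B. L b = 0}"
    by (simp only: card_preimage_le[OF add B(1)])
  also have "\<dots> \<le> p ^ k * p" using Suc ker by (intro mult_le_mono)
  finally show ?case by (simp add: mult.commute)
qed

text \<open>Each step of an invariant chain from \<open>{0}\<close> multiplies the size by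
  \<open>p\<close>, and since \<open>L\<close> maps the enlarged space back into \<open>K\<close>,
  it costs one more power of \<open>L\<close>.\<close>

lemma invariant_subspace_annihilated:
  fixes L :: "'a \<Rightarrow> 'a"
  assumes add: "\<And>x y. L (x + y) = L x + L y" and nil: "\<And>x. (L ^^ N) x = 0"
    and I: "fp_subspace I" "L ` I \<subseteq> I"
  shows "\<exists>k. card I = p ^ k \<and> (\<forall>x\<in>I. (L ^^ k) x = 0)"
proof -
  have "{0} \<subseteq> I" "L ` {0} \<subseteq> {0}" using subspace_0[OF I(1)] additive_0[OF add] by auto
  with add nil subspace_zero I show ?thesis
  proof (induction rule: invariant_chain_induct)
    case base
    show ?case by (intro exI[of _ 0]) simp
  next
    case (step K x)
    then obtain k where k: "card K = p ^ k" "\<And>x. x \<in> K \<Longrightarrow> (L ^^ k) x = 0" by blast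
    have "(L ^^ Suc k) y = 0" if y: "y \<in> K + line x" for y
    proof -
      obtain h n where hn: "h \<in> K" "y = h + nmul n x" using y unfolding mem_plus_line by blast
      have "L h + nmul n (L x) \<in> K"
        using hn step by (intro subspace_add subspace_nmul) auto
      then have "L y \<in> K" using hn by (simp add: add additive_nmul[OF add])
      then show ?thesis using k(2) by (simp add: funpow_swap1)
    qed
    moreover have "card (K + line x) = p ^ Suc k" using k(1) step card_plus_line by simp
    ultimately show ?case by blast
  qed
qed

text \<open>An invariant subspace of size \<open>p ^ k\<close> is killed by \<open>L ^^ k\<close>,
  whose kernel in \<open>B\<close> has at most \<open>p ^ k\<close> elements. So it equals this
  kernel and is determined by \<open>k\<close>, which ranges over 0 to \<open>e\<close>.\<close>

lemma card_invariant_subspaces_le: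
  fixes L :: "'a \<Rightarrow> 'a"
  assumes add: "\<And>x y. L (x + y) = L x + L y" and nil: "\<And>x. (L ^^ N) x = 0"
    and B: "fp_subspace B" "L ` B \<subseteq> B" and ker: "card {b \<in> B. L b = 0} \<le> p"
    and cB: "card B = p ^ e"
  shows "card {I. fp_subspace I \<and> L ` I \<subseteq> I \<and> I \<subseteq> B} \<le> e + 1"
proof -
  have "{I. fp_subspace I \<and> L ` I \<subseteq> I \<and> I \<subseteq> B} \<subseteq> (\<lambda>k. {b \<in> B. (L ^^ k) b = 0}) ` {..e}"
  proof clarify
    fix I assume I: "fp_subspace I" "L ` I \<subseteq> I" "I \<subseteq> B"
    obtain k where k: "card I = p ^ k" "\<And>x. x \<in> I \<Longrightarrow> (L ^^ k) x = 0"
      using invariant_subspace_annihilated[OF add nil I(1,2)] by blast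
    have "p ^ k \<le> p ^ e" using card_mono[OF finite I(3)] unfolding k(1) cB .
    with p_gt_1 have "k \<le> e" by (rule power_le_imp_le_exp)
    moreover have "I \<subseteq> {b \<in> B. (L ^^ k) b = 0}" using I(3) k(2) by blast
    then have "I = {b \<in> B. (L ^^ k) b = 0}"
      using card_kernel_funpow_le[OF add B ker, of k] k(1) by (intro card_seteq) simp_all
    ultimately show "I \<in> (\<lambda>k. {b \<in> B. (L ^^ k) b = 0}) ` {..e}" by blast
  qed
  then have "card {I. fp_subspace I \<and> L ` I \<subseteq> I \<and> I \<subseteq> B}
      \<le> card ((\<lambda>k. {b \<in> B. (L ^^ k) b = 0}) ` {..e})"
    by (intro card_mono finite)
  also have "\<dots> \<le> card {..e}" by (intro card_image_le) simp
  finally show ?thesis by simp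
qed

text \<open>Each such \<open>S\<close> is \<open>S' + line (x + b)\<close> for some \<open>b\<close>
  in \<open>B\<close>, determined only up to \<open>S1\<close>. Two choices of \<open>b\<close>
  differ by an element of \<open>B\<close> that \<open>L\<close> maps into \<open>S1\<close>; there
  are at most \<open>card S1 * p\<close> of these, and dividing by \<open>card S1\<close> leaves
  \<open>p\<close>.\<close>

lemma card_invariant_extensions_le:
  fixes L :: "'a \<Rightarrow> 'a"
  assumes add: "\<And>x y. L (x + y) = L x + L y"
    and B: "fp_subspace B" "L ` B \<subseteq> B" and ker: "card {b \<in> B. L b = 0} \<le> p"
    and K: "fp_subspace K" "B \<subseteq> K" and x: "L x \<in> K" and LK: "L ` K \<subseteq> K"
  shows "card {S. fp_subspace S \<and> L ` S \<subseteq> S \<and> S \<inter> B = S1 \<and> S + B = K + line x \<and> S \<inter> K = S'} \<le> p"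
    (is "card ?G \<le> p")
proof (cases "?G = {}")
  case True
  then show ?thesis by (simp only: card.empty le0)
next
  case False
  then obtain S0 where S0: "S0 \<in> ?G" by blast
  have ex: "\<exists>b. b \<in> B \<and> x + b \<in> S" if S: "S \<in> ?G" for S
  proof -
    have "x \<in> K + line x" using subset_plus_right[OF K(1)] mem_line by blast
    then have "x \<in> S + B" using S by simp
    then obtain s b where "x = s + b" "s \<in> S" "b \<in> B" by (rule set_plus_elim)
    then show ?thesis using subspace_neg[OF B(1), of b] by (intro exI[of _ "- b"]) simp
  qed
  define \<beta> where "\<beta> S = (SOME b. b \<in> B \<and> x + b \<in> S)" for S
  have \<beta>: "\<beta> S \<in> B" "x + \<beta> S \<in> S" if "S \<in> ?G" for S
    using someI_ex[OF ex[OF that]] by (simp_all add: \<beta>_def)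
  have determined: "S = S' + line (x + b)" if S: "S \<in> ?G" and b: "b \<in> B" "x + b \<in> S" for S b
  proof (rule equalityI)
    show "S' + line (x + b) \<subseteq> S" using S b by (intro plus_subset line_subset) auto
    show "S \<subseteq> S' + line (x + b)"
    proof
      fix s assume s: "s \<in> S"
      have "S \<subseteq> S + B" by (rule subset_plus_left[OF B(1)])
      then have "s \<in> K + line x" using s S by blast
      then obtain k n where kn: "k \<in> K" "s = k + nmul n x" by (auto simp: mem_plus_line)
      have "s - nmul n (x + b) \<in> S" using S s b by (intro subspace_diff subspace_nmul) auto
      moreover have "s - nmul n (x + b) = k - nmul n b" using kn by (simp add: nmul_add_right)
      moreover have "k - nmul n b \<in> K" using kn b K by (intro subspace_diff subspace_nmul) auto
      ultimately have "s - nmul n (x + b) \<in> S'" using S by auto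
      moreover have "s = (s - nmul n (x + b)) + nmul n (x + b)" by simp
      ultimately show "s \<in> S' + line (x + b)" unfolding mem_plus_line by blast
    qed
  qed
  define b0 where "b0 = \<beta> S0"
  have S1: "S1 \<subseteq> B" using S0 by blast
  have S1s: "fp_subspace S1" using S0 B subspace_inter by blast
  let ?W = "{b \<in> B. L b \<in> S1}"
  \<comment> \<open>The factor \<open>S1\<close> records the freedom in \<open>b\<close>:
    \<open>\<beta> S + s\<close> is an equally good choice for \<open>S\<close>, and any choice
    recovers \<open>S\<close>.\<close>
  have "inj_on (\<lambda>(s, S). (\<beta> S - b0) + s) (S1 \<times> ?G)"
  proof (rule inj_onI)
    fix u v
    assume u: "u \<in> S1 \<times> ?G" and v: "v \<in> S1 \<times> ?G"
      and eq: "(\<lambda>(s, S). (\<beta> S - b0) + s) u = (\<lambda>(s, S). (\<beta> S - b0) + s) v"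
    obtain s S r R where uv: "u = (s, S)" "v = (r, R)" by (metis surj_pair)
    have s: "s \<in> S1" "S \<in> ?G" and r: "r \<in> S1" "R \<in> ?G" using u v uv by blast+
    have e: "\<beta> S + s = \<beta> R + r" using eq uv by (simp add: algebra_simps)
    have mem: "\<beta> S + s \<in> B \<and> x + (\<beta> S + s) \<in> S" if "s \<in> S1" "S \<in> ?G" for s S
    proof -
      have "s \<in> S" "s \<in> B" using that by blast+
      moreover have "fp_subspace S" using that by blast
      ultimately show ?thesis
        using \<beta>[OF that(2)] B(1) subspace_add[of S "x + \<beta> S" s] subspace_add[of B]
        by (simp add: add.assoc)
    qed
    have "S = S' + line (x + (\<beta> S + s))" using determined[OF s(2)] mem[OF s] by blast
    moreover have "R = S' + line (x + (\<beta> R + r))" using determined[OF r(2)] mem[OF r] by blast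
    ultimately have "S = R" using e by simp
    then show "u = v" using e uv by simp
  qed
  moreover have "(\<lambda>(s, S). (\<beta> S - b0) + s) ` (S1 \<times> ?G) \<subseteq> ?W"
  proof (rule image_subsetI)
    fix u assume u: "u \<in> S1 \<times> ?G"
    obtain s S where us: "u = (s, S)" by (metis surj_pair)
    have s: "s \<in> S1" "S \<in> ?G" using u us by blast+
    \<comment> \<open>Invariance of \<open>R\<close> puts the image in \<open>R\<close>, and
      \<open>L x\<close> in \<open>K\<close> puts it in \<open>K\<close>; all members of the family
      share the intersection \<open>S'\<close> with \<open>K\<close>.\<close>
    have L\<beta>: "L (x + \<beta> R) \<in> S'" if R: "R \<in> ?G" for R
    proof -
      have "L (x + \<beta> R) \<in> R" using R \<beta>[OF R] by blast
      moreover have "L (\<beta> R) \<in> K" using \<beta>(1)[OF R] B K by blast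
      then have "L (x + \<beta> R) \<in> K" using x subspace_add[OF K(1)] by (simp add: add)
      ultimately show ?thesis using R by blast
    qed
    have S's: "fp_subspace S'" using s(2) K(1) subspace_inter by blast
    have "L (x + \<beta> S) - L (x + \<beta> S0) \<in> S'" by (intro subspace_diff S's L\<beta> s S0)
    moreover have "L (x + \<beta> S) - L (x + \<beta> S0) = L (\<beta> S - b0)"
      by (simp add: add additive_diff[OF add] b0_def)
    ultimately have "L (\<beta> S - b0) \<in> S'" by simp
    moreover have bB: "\<beta> S - b0 \<in> B"
      unfolding b0_def by (intro subspace_diff B \<beta> s S0)
    then have "L (\<beta> S - b0) \<in> B" using B by blast
    ultimately have 1: "L (\<beta> S - b0) \<in> S1" using s by blast
    have sB: "s \<in> S" "s \<in> B" using s by blast+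
    then have "L s \<in> S" "L s \<in> B" using s(2) B(2) by blast+
    then have 2: "L s \<in> S1" using s by blast
    have "L (\<beta> S - b0 + s) \<in> S1" using subspace_add[OF S1s 1 2] by (simp add: add)
    moreover have "\<beta> S - b0 + s \<in> B" using bB sB by (intro subspace_add B)
    ultimately show "(\<lambda>(s, S). (\<beta> S - b0) + s) u \<in> ?W" using us by simp
  qed
  ultimately have "card (S1 \<times> ?G) \<le> card ?W" by (intro card_inj_on_le finite)
  also have "\<dots> \<le> card S1 * card {b \<in> B. L b = 0}" by (rule card_preimage_le[OF add B(1)])
  also have "\<dots> \<le> card S1 * p" using ker by simp
  finally have "card S1 * card ?G \<le> card S1 * p" by (simp only: card_cartesian_product)
  moreover have "card S1 > 0" using subspace_0[OF S1s] by (auto simp: card_gt_0_iff)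
  ultimately show ?thesis by (simp only: nat_mult_le_cancel1)
qed

text \<open>Intersecting with \<open>K\<close> sends a supplement for \<open>K + line x\<close> to
  one for \<open>K\<close>, with fibers of size at most \<open>p\<close>, while the space also grows
  by the factor \<open>p\<close>. At the bottom, \<open>S + B = B\<close> forces
  \<open>S = S1\<close>.\<close>

lemma card_invariant_supplements_inter_le:
  fixes L :: "'a \<Rightarrow> 'a"
  assumes add: "\<And>x y. L (x + y) = L x + L y" and nil: "\<And>x. (L ^^ N) x = 0"
    and B: "fp_subspace B" "L ` B \<subseteq> B" and ker: "card {b \<in> B. L b = 0} \<le> p"
    and T: "fp_subspace T" "L ` T \<subseteq> T" "B \<subseteq> T"
  shows "card {S. fp_subspace S \<and> L ` S \<subseteq> S \<and> S \<inter> B = S1 \<and> S + B = T} * card B \<le> card T"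
  using add nil B(1) T B(2)
proof (induction rule: invariant_chain_induct)
  case base
  have "{S. fp_subspace S \<and> L ` S \<subseteq> S \<and> S \<inter> B = S1 \<and> S + B = B} \<subseteq> {S1}"
    using subset_plus_left[OF B(1)] by blast
  then have "card {S. fp_subspace S \<and> L ` S \<subseteq> S \<and> S \<inter> B = S1 \<and> S + B = B} \<le> card {S1}"
    by (intro card_mono finite)
  then show ?case by simp
next
  case (step K x)
  let ?F = "\<lambda>T. {S. fp_subspace S \<and> L ` S \<subseteq> S \<and> S \<inter> B = S1 \<and> S + B = T}"
  let ?G = "\<lambda>S'. {S. fp_subspace S \<and> L ` S \<subseteq> S \<and> S \<inter> B = S1 \<and> S + B = K + line x \<and> S \<inter> K = S'}"
  have "?F (K + line x) \<subseteq> (\<Union>S'\<in>?F K. ?G S')"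
  proof
    fix S assume S: "S \<in> ?F (K + line x)"
    have KT: "K \<subseteq> S + B" using S subset_plus_left[OF line_subspace, of K] by blast
    \<comment> \<open>The modular law again, as \<open>B\<close> lies in \<open>K\<close>.\<close>
    have "S \<inter> K + B = K"
    proof (rule equalityI)
      show "S \<inter> K + B \<subseteq> K" using step(1,3) by (intro plus_subset) auto
      show "K \<subseteq> S \<inter> K + B"
      proof
        fix k assume k: "k \<in> K"
        then obtain s b where sb: "k = s + b" "s \<in> S" "b \<in> B" using KT by (blast elim: set_plus_elim)
        then have "k - b \<in> K" using k step(1,3) by (intro subspace_diff) auto
        then have "s \<in> S \<inter> K" using sb by simp
        then show "k \<in> S \<inter> K + B" using sb by blast
      qed
    qed
    moreover have "fp_subspace (S \<inter> K)" using S step(1) subspace_inter by blast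
    moreover have "L ` (S \<inter> K) \<subseteq> S \<inter> K" using S step(2) by blast
    moreover have "S \<inter> K \<inter> B = S1" using S step(3) by blast
    ultimately have "S \<inter> K \<in> ?F K" by (intro CollectI conjI)
    moreover have "S \<in> ?G (S \<inter> K)" using S by blast
    ultimately show "S \<in> (\<Union>S'\<in>?F K. ?G S')" by (rule UN_I)
  qed
  then have "card (?F (K + line x)) \<le> card (\<Union>S'\<in>?F K. ?G S')" by (intro card_mono finite)
  also have "\<dots> \<le> (\<Sum>S'\<in>?F K. card (?G S'))" by (intro card_UN_le finite)
  also have "\<dots> \<le> (\<Sum>S'\<in>?F K. p)"
    by (intro sum_mono card_invariant_extensions_le add B ker step)
  also have "\<dots> = card (?F K) * p" by simp
  finally have "card (?F (K + line x)) * card B \<le> card (?F K) * p * card B" by (rule mult_le_mono1)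
  also have "\<dots> \<le> p * card K" using mult_le_mono2[OF step(8), of p] by (simp only: ac_simps)
  also have "\<dots> = card (K + line x)" by (rule card_plus_line[OF step(1,6), symmetric])
  finally show ?case .
qed

text \<open>The supplements are sorted by their intersection with \<open>B\<close>, for which at
  most \<open>e + 1\<close> invariant subspaces are available.\<close>

lemma card_invariant_supplements_le:
  fixes L :: "'a \<Rightarrow> 'a"
  assumes add: "\<And>x y. L (x + y) = L x + L y" and nil: "\<And>x. (L ^^ N) x = 0"
    and B: "fp_subspace B" "L ` B \<subseteq> B" and ker: "card {b \<in> B. L b = 0} \<le> p"
    and cB: "card B = p ^ e"
    and T: "fp_subspace T" "L ` T \<subseteq> T" "B \<subseteq> T"
  shows "card {S. fp_subspace S \<and> L ` S \<subseteq> S \<and> S + B = T} * card B \<le> (e + 1) * card T"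
proof -
  let ?I = "{I. fp_subspace I \<and> L ` I \<subseteq> I \<and> I \<subseteq> B}"
  let ?F = "\<lambda>S1. {S. fp_subspace S \<and> L ` S \<subseteq> S \<and> S \<inter> B = S1 \<and> S + B = T}"
  have "{S. fp_subspace S \<and> L ` S \<subseteq> S \<and> S + B = T} \<subseteq> (\<Union>S1\<in>?I. ?F S1)"
  proof
    fix S assume S: "S \<in> {S. fp_subspace S \<and> L ` S \<subseteq> S \<and> S + B = T}"
    have "fp_subspace (S \<inter> B)" using S B subspace_inter by blast
    moreover have "L ` (S \<inter> B) \<subseteq> S \<inter> B" using S B by blast
    ultimately have "S \<inter> B \<in> ?I" by blast
    then show "S \<in> (\<Union>S1\<in>?I. ?F S1)" using S by blast
  qed
  then have "card {S. fp_subspace S \<and> L ` S \<subseteq> S \<and> S + B = T} \<le> card (\<Union>S1\<in>?I. ?F S1)"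
    by (intro card_mono finite)
  also have "\<dots> \<le> (\<Sum>S1\<in>?I. card (?F S1))" by (intro card_UN_le finite)
  finally have "card {S. fp_subspace S \<and> L ` S \<subseteq> S \<and> S + B = T} * card B
      \<le> (\<Sum>S1\<in>?I. card (?F S1)) * card B" by (rule mult_le_mono1)
  also have "\<dots> = (\<Sum>S1\<in>?I. card (?F S1) * card B)" by (rule sum_distrib_right)
  also have "\<dots> \<le> (\<Sum>S1\<in>?I. card T)"
    by (intro sum_mono card_invariant_supplements_inter_le[OF add nil B ker T])
  also have "\<dots> = card ?I * card T" by simp
  also have "\<dots> \<le> (e + 1) * card T"
    by (intro mult_le_mono1 card_invariant_subspaces_le[OF add nil B ker cB])
  finally show ?thesis .
qed

text \<open>A complement in \<open>T\<close> of a subspace \<open>D\<close> of \<open>B\<close> is a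
  supplement of \<open>B\<close>, so counting the complements of one suitable \<open>D\<close>
  suffices.\<close>

lemma card_supplements_ge:
  assumes B: "fp_subspace B" and T: "fp_subspace (T :: 'a set)" "B \<subseteq> T"
    and cB: "card B = p ^ e" and e: "e \<ge> 1"
  shows "p ^ (e\<^sup>2 div 4) * card T \<le> card {S. fp_subspace S \<and> S + B = T} * card B"
proof -
  \<comment> \<open>Half of \<open>e\<close>, rounded up: this split makes
    \<open>g * (e - g)\<close> as large as possible, namely \<open>e\<^sup>2 div 4\<close>.\<close>
  define g where "g = e - e div 2"
  have g: "g \<le> e" "g \<ge> 1" "g + e div 2 = e" using e by (auto simp: g_def)
  have q: "g * (e div 2) = e\<^sup>2 div 4"
  proof (cases "even e")
    case True
    then obtain m where "e = 2 * m" by blast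
    then show ?thesis by (simp add: g_def power2_eq_square)
  next
    case False
    then obtain m where "e = 2 * m + 1" by (rule oddE)
    moreover have "(2 * m + 1)\<^sup>2 = 4 * (m * m + m) + 1" by (simp add: power2_eq_square)
    ultimately show ?thesis by (simp add: g_def)
  qed
  obtain t where t: "card T = card B * p ^ t" using card_subspace_over[OF B T] by blast
  obtain D where D: "fp_subspace D" "D \<subseteq> B" "card D = p ^ g"
    using exists_subspace_card[OF B cB g(1)] by blast
  have DT: "D \<subseteq> T" using D T by blast
  obtain u where u: "card T = card D * p ^ u"
    "card D ^ u \<le> card {S. fp_subspace S \<and> S \<inter> D = {0} \<and> S + D = T}"
    using card_complements[OF D(1) T(1) DT] by blast
  have "p ^ (g + u) = p ^ (e + t)" using t u(1) cB D(3) by (simp add: power_add)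
  then have "g + u = e + t" using p_gt_1 power_inject_exp by blast
  then have u_eq: "u = e div 2 + t" using g by linarith
  \<comment> \<open>The codimension of \<open>D\<close> in \<open>T\<close> is
    \<open>e div 2 + t\<close>, so \<open>g * u\<close> splits into \<open>e\<^sup>2 div 4\<close>
    and \<open>g * t\<close>, and the latter covers the exponent of
    \<open>card T / card B\<close>.\<close>
  have "t \<le> g * t" using g(2) by simp
  then have "e\<^sup>2 div 4 + t \<le> g * u" unfolding u_eq by (simp add: distrib_left q)
  then have "p ^ (e\<^sup>2 div 4 + t) \<le> p ^ (g * u)" using p_gt_1 by (intro power_increasing) auto
  also have "\<dots> = card D ^ u" by (simp add: D power_mult)
  also note u(2)
  also have "card {S. fp_subspace S \<and> S \<inter> D = {0} \<and> S + D = T} \<le> card {S. fp_subspace S \<and> S + B = T}"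
  proof (intro card_mono finite subsetI CollectI)
    fix S assume "S \<in> {S. fp_subspace S \<and> S \<inter> D = {0} \<and> S + D = T}"
    then have S: "fp_subspace S" "S + D = T" by blast+
    have "S \<subseteq> T" using subset_plus_left[OF D(1), of S] S by simp
    then have "S + B \<subseteq> T" using T by (intro plus_subset)
    moreover have "T \<subseteq> S + B" using S(2) set_plus_mono2[OF order_refl D(2)] by blast
    ultimately show "fp_subspace S \<and> S + B = T" using S by blast
  qed
  finally have "p ^ (e\<^sup>2 div 4 + t) * card B \<le> card {S. fp_subspace S \<and> S + B = T} * card B"
    by (rule mult_le_mono1)
  then show ?thesis by (simp add: t power_add ac_simps)
qed

text \<open>Both counts are compared on each class of subspaces \<open>S\<close> with the same
  \<open>T = S + B\<close>; if \<open>S\<close> is invariant, so is \<open>T\<close>.\<close>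

lemma card_invariant_le_card_subspaces:
  fixes L :: "'a \<Rightarrow> 'a"
  assumes add: "\<And>x y. L (x + y) = L x + L y" and nil: "\<And>x. (L ^^ N) x = 0"
    and B: "fp_subspace B" "L ` B \<subseteq> B" and ker: "card {b \<in> B. L b = 0} \<le> p"
    and cB: "card B = p ^ e" and e: "e \<ge> 1"
  shows "p ^ (e\<^sup>2 div 4) * card {S. fp_subspace S \<and> L ` S \<subseteq> S}
    \<le> (e + 1) * card {S :: 'a set. fp_subspace S}"
proof -
  let ?T = "{T. fp_subspace T \<and> L ` T \<subseteq> T \<and> B \<subseteq> T}"
  let ?I = "\<lambda>T. {S. fp_subspace S \<and> L ` S \<subseteq> S \<and> S + B = T}"
  let ?A = "\<lambda>T. {S. fp_subspace S \<and> S + B = T}"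
  let ?q = "p ^ (e\<^sup>2 div 4)"
  have "{S. fp_subspace S \<and> L ` S \<subseteq> S} \<subseteq> (\<Union>T\<in>?T. ?I T)"
  proof
    fix S assume S: "S \<in> {S. fp_subspace S \<and> L ` S \<subseteq> S}"
    have "L ` (S + B) \<subseteq> S + B"
    proof (rule image_subsetI)
      fix y assume "y \<in> S + B"
      then obtain s b where "y = s + b" "s \<in> S" "b \<in> B" by (rule set_plus_elim)
      moreover from this have "L s \<in> S" "L b \<in> B" using S B by blast+
      ultimately show "L y \<in> S + B" by (simp add: add set_plus_intro)
    qed
    moreover have "fp_subspace S" using S by blast
    then have "fp_subspace (S + B)" "B \<subseteq> S + B"
      by (rule subspace_plus[OF _ B(1)], rule subset_plus_right)
    ultimately have "S + B \<in> ?T" by (intro CollectI conjI)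
    moreover have "S \<in> ?I (S + B)" using S by blast
    ultimately show "S \<in> (\<Union>T\<in>?T. ?I T)" by (rule UN_I)
  qed
  then have "card {S. fp_subspace S \<and> L ` S \<subseteq> S} \<le> card (\<Union>T\<in>?T. ?I T)"
    by (intro card_mono finite)
  also have "\<dots> \<le> (\<Sum>T\<in>?T. card (?I T))" by (intro card_UN_le finite)
  finally have "?q * card {S. fp_subspace S \<and> L ` S \<subseteq> S} \<le> ?q * (\<Sum>T\<in>?T. card (?I T))"
    by (rule mult_le_mono2)
  also have "\<dots> = (\<Sum>T\<in>?T. ?q * card (?I T))" by (rule sum_distrib_left)
  also have "\<dots> \<le> (\<Sum>T\<in>?T. (e + 1) * card (?A T))"
  proof (rule sum_mono)
    fix T assume "T \<in> ?T"
    then have T: "fp_subspace T" "L ` T \<subseteq> T" "B \<subseteq> T" by blast+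
    \<comment> \<open>Upper and lower bound both contain the ratio of \<open>card T\<close> to
      \<open>card B\<close>, which drops out.\<close>
    have "?q * (card (?I T) * card B) \<le> ?q * ((e + 1) * card T)"
      by (intro mult_le_mono2 card_invariant_supplements_le[OF add nil B ker cB T])
    also have "\<dots> = (e + 1) * (?q * card T)" by (simp only: ac_simps)
    also have "\<dots> \<le> (e + 1) * (card (?A T) * card B)"
      by (intro mult_le_mono2 card_supplements_ge[OF B(1) T(1,3) cB e])
    finally have "card B * (?q * card (?I T)) \<le> card B * ((e + 1) * card (?A T))"
      by (simp only: ac_simps)
    moreover have "card B > 0" using cB p_gt_1 by simp
    ultimately show "?q * card (?I T) \<le> (e + 1) * card (?A T)"
      by (simp only: nat_mult_le_cancel1)
  qed
  also have "\<dots> = (e + 1) * (\<Sum>T\<in>?T. card (?A T))" by (rule sum_distrib_left[symmetric])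
  also have "(\<Sum>T\<in>?T. card (?A T)) = card (\<Union>T\<in>?T. ?A T)"
    by (intro card_UN_disjoint[symmetric] ballI impI finite) blast
  also have "(e + 1) * card (\<Union>T\<in>?T. ?A T) \<le> (e + 1) * card {S :: 'a set. fp_subspace S}"
    by (intro mult_le_mono2 card_mono finite) blast
  finally show ?thesis .
qed

section \<open>Cyclic subspaces\<close>

text \<open>\<open>B\<close> is spanned by the iterates of \<open>c\<close>. From
  \<open>B = L B + line c\<close> the image has index at most \<open>p\<close> in \<open>B\<close>,
  which bounds the kernel by \<open>p\<close>.\<close>

lemma cyclic_subspace:
  fixes L :: "'a \<Rightarrow> 'a"
  assumes add: "\<And>x y. L (x + y) = L x + L y" and nil: "\<And>x. (L ^^ e) x = 0"
    and e: "e \<ge> 1" and c: "(L ^^ (e - 1)) c \<noteq> 0"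
  shows "\<exists>B. fp_subspace B \<and> L ` B \<subseteq> B \<and> card {b \<in> B. L b = 0} \<le> p \<and> card B = p ^ e"
proof -
  define B where "B = addspan (range (\<lambda>i. (L ^^ i) c))"
  have B: "fp_subspace B" unfolding B_def by (rule addspan_subspace)
  have gen: "(L ^^ i) c \<in> B" for i unfolding B_def by (intro addspan.base rangeI)
  have neg: "L (- y) = - L y" for y
    using additive_diff[of L 0 y] add additive_0[of L] by simp
  have "L y \<in> B" if "y \<in> B" for y
    using that[unfolded B_def]
  proof induction
    case zero
    then show ?case using B subspace_0 additive_0[OF add] by simp
  next
    case (base y)
    then show ?case using gen[of "Suc _"] by auto
  next
    case (add y z)
    then show ?case using B subspace_add assms(1) by simp
  next
    case (neg y)
    then show ?case using B subspace_neg \<open>\<And>y. L (- y) = - L y\<close> by simp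
  qed
  then have inv: "L ` B \<subseteq> B" by blast
  have LB: "fp_subspace (L ` B)"
    unfolding fp_subspace_def
  proof (intro conjI ballI)
    show "0 \<in> L ` B" using subspace_0[OF B] additive_0[OF add] by (metis image_eqI)
    show "x + y \<in> L ` B" if xy: "x \<in> L ` B" "y \<in> L ` B" for x y
    proof -
      obtain a b where "a \<in> B" "b \<in> B" "x = L a" "y = L b" using xy by blast
      then show ?thesis using subspace_add[OF B] by (metis add image_eqI)
    qed
    show "- x \<in> L ` B" if x: "x \<in> L ` B" for x
    proof -
      obtain a where "a \<in> B" "x = L a" using x by blast
      then show ?thesis using subspace_neg[OF B] by (metis neg image_eqI)
    qed
  qed
  have sum: "fp_subspace (L ` B + line c)" by (intro subspace_plus LB line_subspace)
  have "y \<in> L ` B + line c" if "y \<in> B" for y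
    using that[unfolded B_def]
  proof induction
    case zero
    then show ?case by (rule subspace_0[OF sum])
  next
    case (base y)
    then obtain i where i: "y = (L ^^ i) c" by blast
    show ?case
    proof (cases i)
      case 0
      then show ?thesis using i mem_line subset_plus_right[OF LB] by auto
    next
      case (Suc j)
      then have "y \<in> L ` B" using i gen[of j] by simp
      then show ?thesis using subset_plus_left[OF line_subspace] by blast
    qed
  next
    case (add y z)
    then show ?case by (intro subspace_add[OF sum])
  next
    case (neg y)
    then show ?case by (intro subspace_neg[OF sum])
  qed
  then have "card B \<le> card (L ` B + line c)" by (intro card_mono finite subsetI)
  also have "\<dots> \<le> p * card (L ` B)" by (rule card_plus_line_le)
  finally have "card B \<le> card (L ` B) * p" by (simp only: mult.commute)
  with card_kernel_image_le[OF add B]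
  have "card (L ` B) * card {b \<in> B. L b = 0} \<le> card (L ` B) * p" by (rule le_trans)
  moreover have "card (L ` B) > 0" using subspace_0[OF LB] by (auto simp: card_gt_0_iff)
  ultimately have ker: "card {b \<in> B. L b = 0} \<le> p" by (simp only: nat_mult_le_cancel1)
  obtain k where k: "card B = p ^ k" "\<And>x. x \<in> B \<Longrightarrow> (L ^^ k) x = 0"
    using invariant_subspace_annihilated[OF add nil B inv] by blast
  \<comment> \<open>\<open>L ^^ k\<close> kills \<open>B\<close>, but \<open>L ^^ (e - 1)\<close>
    does not kill \<open>c\<close>.\<close>
  have "k \<ge> e"
  proof (rule ccontr)
    assume "\<not> k \<ge> e"
    then have "e - 1 = k + (e - 1 - k)" by simp
    then have "(L ^^ (e - 1)) c = (L ^^ k) ((L ^^ (e - 1 - k)) c)"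
      by (metis funpow_add comp_apply)
    then show False using k(2)[OF gen] c by simp
  qed
  \<comment> \<open>Conversely, \<open>B\<close> is the kernel of \<open>L ^^ e\<close>, which has
    at most \<open>p ^ e\<close> elements.\<close>
  have "{b \<in> B. (L ^^ e) b = 0} = B" using nil by blast
  then have "p ^ k \<le> p ^ e"
    using card_kernel_funpow_le[OF add B inv ker, of e] k(1) by simp
  with p_gt_1 have "k \<le> e" by (rule power_le_imp_le_exp)
  with \<open>k \<ge> e\<close> have "card B = p ^ e" using k(1) by simp
  with B inv ker show ?thesis by blast
qed

end

section \<open>Polarization\<close>

lemma funpow_mult_commute: "((*) x ^^ j) (y * c) = y * ((*) x ^^ j) c" for x :: "'a::comm_ring"
  by (induction j) (simp_all add: mult.left_commute)

lemma funpow_mult_nmul: "((*) x ^^ j) (nmul n c) = nmul n (((*) x ^^ j) c)" for x :: "'a::comm_ring"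
  by (induction j) (simp_all add: mult_nmul)

text \<open>Polynomial functions of degree less than \<open>m\<close>. The ring has no unit, so the monomial
  \<open>c x\<^sup>j\<close> is the \<open>j\<close>-fold multiplication by \<open>x\<close> applied to \<open>c\<close>.\<close>

inductive poly_fun :: "nat \<Rightarrow> ('a::comm_ring \<Rightarrow> 'a) \<Rightarrow> bool" for m where
  zero: "poly_fun m (\<lambda>_. 0)"
| monomial: "j < m \<Longrightarrow> poly_fun m (\<lambda>x. ((*) x ^^ j) c)"
| add: "poly_fun m f \<Longrightarrow> poly_fun m g \<Longrightarrow> poly_fun m (\<lambda>x. f x + g x)"

lemma poly_fun_0: "poly_fun 0 f \<Longrightarrow> f x = 0"
  by (induction rule: poly_fun.induct) auto

lemma poly_fun_mono: "poly_fun m f \<Longrightarrow> m \<le> n \<Longrightarrow> poly_fun n f"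
  by (induction rule: poly_fun.induct) (auto intro: poly_fun.intros)

lemma poly_fun_mult_arg: "poly_fun m f \<Longrightarrow> poly_fun (Suc m) (\<lambda>x. x * f x)"
proof (induction rule: poly_fun.induct)
  case zero
  show ?case using poly_fun.zero[of "Suc m"] by simp
next
  case (monomial j c)
  then show ?case using poly_fun.monomial[of "Suc j" "Suc m" c] by simp
next
  case (add f g)
  then show ?case using poly_fun.add[of "Suc m" "\<lambda>x. x * f x" "\<lambda>x. x * g x"]
    by (simp add: distrib_left)
qed

lemma poly_fun_mult_const: "poly_fun m f \<Longrightarrow> poly_fun m (\<lambda>x. y * f x)"
proof (induction rule: poly_fun.induct)
  case zero
  show ?case using poly_fun.zero[of m] by simp
next
  case (monomial j c)
  then show ?case using poly_fun.monomial[of j m "y * c"] by (simp add: funpow_mult_commute)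
next
  case (add f g)
  then show ?case using poly_fun.add[of m "\<lambda>x. y * f x" "\<lambda>x. y * g x"]
    by (simp add: distrib_left)
qed

lemma poly_fun_monomial_nmul:
  assumes "j < m"
  shows "poly_fun m (\<lambda>x. nmul n (((*) x ^^ j) c))"
  using poly_fun.monomial[OF assms, of "nmul n c"] by (simp add: funpow_mult_nmul)

text \<open>The two leading terms of the binomial expansion in \<open>x\<close>; the remainder has
  degree less than \<open>m\<close>.\<close>

lemma monomial_shift:
  fixes y c :: "'a::comm_ring"
  shows "\<exists>g. poly_fun m g \<and> (\<forall>x. ((*) (x + y) ^^ Suc m) c
    = ((*) x ^^ Suc m) c + nmul (Suc m) (((*) x ^^ m) (y * c)) + g x)"
proof (induction m)
  case 0
  show ?case
    by (rule exI[of _ "\<lambda>_. 0"]) (simp add: poly_fun.zero distrib_right)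
next
  case (Suc m)
  then obtain g where g: "poly_fun m g" "\<And>x. ((*) (x + y) ^^ Suc m) c
    = ((*) x ^^ Suc m) c + nmul (Suc m) (((*) x ^^ m) (y * c)) + g x" by blast
  \<comment> \<open>The terms of degree at most \<open>m\<close> after multiplying the expansion by
    \<open>x + y\<close>. The two remaining terms of degree \<open>Suc m\<close> combine to the
    coefficient \<open>Suc (Suc m)\<close>.\<close>
  let ?h = "\<lambda>x. nmul (Suc m) (((*) x ^^ m) (y * (y * c))) + (x * g x + y * g x)"
  have "poly_fun (Suc m) ?h"
    using g(1) by (intro poly_fun.add poly_fun_monomial_nmul poly_fun_mult_arg
        poly_fun_mult_const[OF poly_fun_mono[OF g(1)]]) auto
  moreover have "((*) (x + y) ^^ Suc (Suc m)) c
    = ((*) x ^^ Suc (Suc m)) c + nmul (Suc (Suc m)) (((*) x ^^ Suc m) (y * c)) + ?h x" for x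
  proof -
    let ?u = "((*) x ^^ Suc m) c" and ?v = "((*) x ^^ m) (y * c)"
    have "((*) (x + y) ^^ Suc (Suc m)) c = (x + y) * (((*) (x + y) ^^ Suc m) c)" by simp
    also have "\<dots> = (x + y) * (?u + nmul (Suc m) ?v + g x)" by (simp only: g(2))
    also have "\<dots> = x * ?u + y * ?u + x * nmul (Suc m) ?v + y * nmul (Suc m) ?v + (x * g x + y * g x)"
      by (simp only: distrib_left distrib_right ac_simps)
    also have "x * ?u = ((*) x ^^ Suc (Suc m)) c" by simp
    also have "y * ?u = ((*) x ^^ Suc m) (y * c)" by (simp only: funpow_mult_commute)
    also have "x * nmul (Suc m) ?v = nmul (Suc m) (((*) x ^^ Suc m) (y * c))"
      by (simp only: mult_nmul funpow.simps comp_apply)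
    also have "y * nmul (Suc m) ?v = nmul (Suc m) (((*) x ^^ m) (y * (y * c)))"
      by (simp only: mult_nmul funpow_mult_commute)
    finally show ?thesis by (simp only: nmul_Suc[of "Suc m"] add.assoc)
  qed
  ultimately show ?case by blast
qed

text \<open>A finite difference lowers the degree of a polynomial function.\<close>

lemma poly_fun_shift:
  assumes "poly_fun (Suc m) f"
  shows "\<exists>g. poly_fun m g \<and> (\<forall>x. f (x + y) = f x + g x)"
  using assms
proof (induction rule: poly_fun.induct)
  case zero
  show ?case by (rule exI[of _ "\<lambda>_. 0"]) (simp add: poly_fun.zero)
next
  case (monomial j c)
  show ?case
  proof (cases j)
    case 0
    then show ?thesis by (intro exI[of _ "\<lambda>_. 0"]) (simp add: poly_fun.zero)
  next
    case (Suc i)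
    obtain g where g: "poly_fun i g" "\<And>x. ((*) (x + y) ^^ Suc i) c
      = ((*) x ^^ Suc i) c + nmul (Suc i) (((*) x ^^ i) (y * c)) + g x"
      using monomial_shift by blast
    have "i < m" using monomial Suc by simp
    then have "poly_fun m (\<lambda>x. nmul (Suc i) (((*) x ^^ i) (y * c)) + g x)"
      by (intro poly_fun.add poly_fun_monomial_nmul poly_fun_mono[OF g(1)]) auto
    then show ?thesis unfolding Suc g(2) add.assoc by blast
  qed
next
  case (add f1 f2)
  then obtain g1 g2 where "poly_fun m g1" "\<And>x. f1 (x + y) = f1 x + g1 x"
    "poly_fun m g2" "\<And>x. f2 (x + y) = f2 x + g2 x" by blast
  then show ?case
    by (intro exI[of _ "\<lambda>x. g1 x + g2 x"] conjI poly_fun.add) (simp_all add: ac_simps)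
qed

lemma foldr_mult_commute: "foldr (*) ys (y * c) = y * foldr (*) ys c" for c :: "'a::comm_ring"
  by (induction ys) (simp_all add: mult.left_commute)

lemma foldr_mult_nmul: "foldr (*) ys (nmul n c) = nmul n (foldr (*) ys c)" for c :: "'a::comm_ring"
  by (induction ys) (simp_all add: mult_nmul)

text \<open>Taking the difference in direction \<open>y\<close> turns the leading coefficient
  \<open>c\<close> into \<open>y * c\<close> times the degree, so iterating produces the factorial.
  The lower-order term \<open>f\<close> is carried along because differences create such terms even
  from a pure monomial.\<close>

lemma polarization:
  fixes c :: "'a::comm_ring"
  assumes "poly_fun (length ys) f" and "\<And>x. ((*) x ^^ length ys) c + f x = 0"
  shows "nmul (fact (length ys)) (foldr (*) ys c) = 0"
  using assms
proof (induction ys arbitrary: c f)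
  case Nil
  then show ?case by (simp add: poly_fun_0)
next
  case (Cons y ys)
  let ?m = "length ys"
  obtain g where g: "poly_fun ?m g" "\<And>x. ((*) (x + y) ^^ Suc ?m) c
    = ((*) x ^^ Suc ?m) c + nmul (Suc ?m) (((*) x ^^ ?m) (y * c)) + g x"
    using monomial_shift by blast
  obtain h where h: "poly_fun ?m h" "\<And>x. f (x + y) = f x + h x"
    using poly_fun_shift[of ?m f y] Cons.prems(1) by auto
  have "((*) x ^^ ?m) (nmul (Suc ?m) (y * c)) + (g x + h x) = 0" for x
  proof -
    have "0 = ((*) (x + y) ^^ Suc ?m) c + f (x + y)" using Cons.prems(2)[of "x + y"] by simp
    also have "\<dots> = (((*) x ^^ Suc ?m) c + f x) + (nmul (Suc ?m) (((*) x ^^ ?m) (y * c)) + (g x + h x))"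
      by (simp only: g(2) h(2) ac_simps)
    also have "((*) x ^^ Suc ?m) c + f x = 0" using Cons.prems(2)[of x] by simp
    finally show ?thesis by (simp only: funpow_mult_nmul add_0)
  qed
  with poly_fun.add[OF g(1) h(1)]
  have "nmul (fact ?m) (foldr (*) ys (nmul (Suc ?m) (y * c))) = 0" by (rule Cons.IH)
  then have "nmul (fact ?m * Suc ?m) (y * foldr (*) ys c) = 0"
    by (simp only: foldr_mult_nmul foldr_mult_commute nmul_mult)
  then show ?case by (simp add: mult.commute[of "fact ?m"])
qed

section \<open>Powers of the algebra\<close>

lemma nprod_append: "vs \<noteq> [] \<Longrightarrow> nprod (us @ vs) = foldr (*) us (nprod vs)"
proof (induction us)
  case (Cons u us)
  moreover from this obtain w ws where "us @ vs = w # ws" by (cases "us @ vs") auto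
  ultimately show ?case by simp
qed simp

lemma nprod_mem_alg_pow: "length xs = k \<Longrightarrow> nprod xs \<in> alg_pow k"
  unfolding alg_pow_def by (intro addspan.base) blast

lemma alg_pow_nonzero:
  assumes "alg_pow k \<noteq> ({0} :: 'a::comm_ring set)"
  obtains xs :: "'a::comm_ring list" where "length xs = k" "nprod xs \<noteq> 0"
proof -
  have "\<exists>xs :: 'a list. length xs = k \<and> nprod xs \<noteq> 0"
  proof (rule ccontr)
    assume "\<nexists>xs :: 'a list. length xs = k \<and> nprod xs \<noteq> 0"
    then have *: "nprod xs = 0" if "length xs = k" for xs :: "'a list" using that by blast
    have "y = 0" if "y \<in> alg_pow k" for y :: 'a
      using that[unfolded alg_pow_def] by induction (auto simp: *)
    moreover have "0 \<in> (alg_pow k :: 'a set)" unfolding alg_pow_def by (rule addspan.zero)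
    ultimately show False using assms by blast
  qed
  then show ?thesis using that by blast
qed

theorem theorem2p8:
  fixes p e :: nat
  assumes "prime p"
    and "char_p_alg p TYPE('a::{comm_ring, finite})"
    and "\<exists>x::'a. x \<noteq> 0"
    and "alg_pow p = ({0} :: 'a set)"
    and "e \<ge> 1"
    and "alg_pow e \<noteq> ({0} :: 'a set)"
    and "alg_pow (e + 1) = ({0} :: 'a set)"
  shows "real (card {I :: 'a set. alg_ideal I}) / real (card {S :: 'a set. fp_subspace S})
           \<le> (2 * real e - 1) / real p ^ (e\<^sup>2 div 4)"
proof -
  interpret elementary_abelian p "TYPE('a)"
    using assms(1,2) by unfold_locales (auto simp: char_p_alg_def nmul_def)
  let ?i = "card {I :: 'a set. alg_ideal I}" and ?s = "card {S :: 'a set. fp_subspace S}"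
  have s_pos: "?s > 0" using subspace_zero by (auto simp: card_gt_0_iff)
  show ?thesis
  proof (cases "e = 1")
    case True
    \<comment> \<open>Here the right-hand side is 1, and ideals are subspaces.\<close>
    have "?i \<le> ?s" by (intro card_mono finite) (auto simp: alg_ideal_def)
    then show ?thesis using True s_pos by simp
  next
    case False
    then have e2: "e \<ge> 2" using assms(5) by simp
    obtain xs :: "'a list" where xs: "length xs = e" "nprod xs \<noteq> 0"
      using alg_pow_nonzero[OF assms(6)] .
    \<comment> \<open>Otherwise a nonzero product of \<open>e\<close> factors, with its tail
      collapsed into one factor, would be a product of exactly \<open>p\<close> factors.\<close>
    have "e < p"
    proof (rule ccontr)
      assume "\<not> e < p"
      then have vs: "drop (p - 1) xs \<noteq> []" "length (take (p - 1) xs) = p - 1"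
        using xs p_gt_1 by auto
      have "nprod xs = nprod (take (p - 1) xs @ drop (p - 1) xs)" by simp
      also have "\<dots> = nprod (take (p - 1) xs @ [nprod (drop (p - 1) xs)])"
        by (simp only: nprod_append[OF vs(1)] nprod_append[OF not_Cons_self2] nprod.simps)
      also have "\<dots> \<in> alg_pow p" using vs(2) p_gt_1 by (intro nprod_mem_alg_pow) simp
      finally show False using assms(4) xs by simp
    qed
    define ys where "ys = butlast xs"
    define c where "c = last xs"
    have "xs \<noteq> []" using xs(1) e2 by auto
    then have xs_eq: "xs = ys @ [c]" by (simp add: ys_def c_def)
    have len: "length ys = e - 1" using xs(1) by (simp add: ys_def)
    have nz: "foldr (*) ys c \<noteq> 0" using xs(2) by (simp add: xs_eq nprod_append)
    \<comment> \<open>If all these powers vanished on \<open>c\<close>, polarization would make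
      \<open>(e - 1)!\<close> times a nonzero product vanish, although \<open>p\<close> does not
      divide this factorial.\<close>
    have "\<exists>a. ((*) a ^^ (e - 1)) c \<noteq> 0"
    proof (rule ccontr)
      assume "\<nexists>a. ((*) a ^^ (e - 1)) c \<noteq> 0"
      then have "nmul (fact (length ys)) (foldr (*) ys c) = 0"
        by (intro polarization[where f = "\<lambda>_. 0"]) (simp_all add: len poly_fun.zero)
      moreover have "\<not> p dvd fact (length ys)"
        using \<open>e < p\<close> prime by (simp add: len prime_dvd_fact_iff)
      ultimately show False using nmul_cancel[OF subspace_zero] nz by auto
    qed
    then obtain a where a: "((*) a ^^ (e - 1)) c \<noteq> 0" by blast
    have nil: "((*) a ^^ e) x = 0" for x
    proof -
      have "((*) a ^^ e) x = nprod (replicate e a @ [x])"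
        by (simp add: nprod_append foldr_replicate)
      also have "\<dots> \<in> alg_pow (e + 1)" by (intro nprod_mem_alg_pow) simp
      finally show ?thesis using assms(7) by simp
    qed
    obtain B where B: "fp_subspace B" "(*) a ` B \<subseteq> B" "card {b \<in> B. a * b = 0} \<le> p" "card B = p ^ e"
      using cyclic_subspace[OF distrib_left nil assms(5) a] by blast
    have "{I :: 'a set. alg_ideal I} \<subseteq> {S. fp_subspace S \<and> (*) a ` S \<subseteq> S}"
      by (auto simp: alg_ideal_def)
    then have "?i \<le> card {S. fp_subspace S \<and> (*) a ` S \<subseteq> S}" by (intro card_mono finite)
    then have "p ^ (e\<^sup>2 div 4) * ?i \<le> p ^ (e\<^sup>2 div 4) * card {S. fp_subspace S \<and> (*) a ` S \<subseteq> S}"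
      by (rule mult_le_mono2)
    also have "\<dots> \<le> (e + 1) * ?s"
      by (rule card_invariant_le_card_subspaces[OF distrib_left nil B assms(5)])
    finally have "real (p ^ (e\<^sup>2 div 4) * ?i) \<le> real ((e + 1) * ?s)" by (simp only: of_nat_le_iff)
    also have "\<dots> \<le> (2 * real e - 1) * real ?s"
      \<comment> \<open>This is \<open>e + 1 <= 2 * e - 1\<close>, where \<open>e >= 2\<close>
        enters.\<close>
      using e2 unfolding of_nat_mult by (intro mult_right_mono) auto
    finally have "real ?i * real p ^ (e\<^sup>2 div 4) \<le> (2 * real e - 1) * real ?s"
      by (simp add: mult.commute)
    moreover have "real p ^ (e\<^sup>2 div 4) > 0" using p_gt_1 by simp
    ultimately show ?thesis using s_pos by (simp add: divide_simps mult.commute)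
  qed
qed

end
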